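(* Let $n\ge 2$ and $a\ge 2\sqrt{n-1}$, let $f(x)=a|x^{(1)}|+\sum_{i=2}^n x^{(i)}$ on $\mathbb{R}^n$, and let $b=\dfrac{a-\sqrt{a^2-3(n-1)}}{3(n-1)}$. Let scaled memoryless BFGS be applied to $f$ from a starting point $x_0$ with $x_0^{(1)}\neq 0$, using an Armijo-Wolfe line search, and suppose that at least one of the following holds: (i) the Armijo parameter satisfies $\dfrac{1}{c_1}-1<\dfrac{a}{(n-1)b}$; (ii) the line search satisfies $t_k\le 2$ for all $k\ge 1$ (as is the case, for example, for the Armijo-Wolfe bracketing line search). Then $$\lim_{N\to\infty}\gamma_N=0,$$ where $\gamma_N=\dfrac{|s_{N-1}^{(1)}|}{2a}$ is the scale factor, and $x_N$ converges to a non-optimal point $\bar x$ (that is, not a minimizer of $f$) of the form $$\bar x=[0,\bar x^{(2)},\dots,\bar x^{(n)}]^T.$$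
   Context: Superscript $(i)$ denotes the $i$-th component of a vector. The function $f$ is differentiable exactly at points with $x^{(1)}\neq 0$. Fix parameters $0<c_1<c_2<1$ (the Armijo and Wolfe parameters). Given $x$ at which $f$ is differentiable and a direction $d$ with $\nabla f(x)^Td<0$, a steplength $t>0$ satisfies the Armijo condition if $f(x+td)\le f(x)+c_1t\nabla f(x)^Td$, and the Wolfe condition if $\nabla f(x+td)$ exists and $\nabla f(x+td)^Td\ge c_2\nabla f(x)^Td$. An Armijo-Wolfe line search is any rule returning some $t$ satisfying both conditions. Scaled memoryless BFGS (with input $x_0$): set $d_0=-\nabla f(x_0)$. For $k=1,2,3,\dots$: let $t_{k-1}$ be a steplength satisfying the Armijo and Wolfe conditions at $x_{k-1}$ along $d_{k-1}$ (if none exists, terminate); set $x_k=x_{k-1}+t_{k-1}d_{k-1}$, $s_{k-1}=x_k-x_{k-1}$, $y_{k-1}=\nabla f(x_k)-\nabla f(x_{k-1})$, $V_{k-1}=I-\dfrac{y_{k-1}s_{k-1}^T}{y_{k-1}^Ts_{k-1}}$, $H_k=\dfrac{s_{k-1}^Ty_{k-1}}{y_{k-1}^Ty_{k-1}}V_{k-1}^TV_{k-1}+\dfrac{s_{k-1}s_{k-1}^T}{s_{k-1}^Ty_{k-1}}$, and $d_k=-H_k\nabla f(x_k)$. For this $f$ the scale factor $\dfrac{s_{k-1}^Ty_{k-1}}{y_{k-1}^Ty_{k-1}}$ equals $\gamma_k=|s_{k-1}^{(1)}|/(2a)$. Armijo-Wolfe bracketing line search: start with $\alpha=0$, $\beta=+\infty$,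 $t=1$. Repeat: if the Armijo condition fails at $t$, set $\beta\leftarrow t$; else if the Wolfe condition fails at $t$, set $\alpha\leftarrow t$; else stop and return $t$. Then, if $\beta<+\infty$ set $t\leftarrow(\alpha+\beta)/2$, otherwise set $t\leftarrow 2\alpha$. *)

theory Defs
  imports "HOL-Analysis.Analysis" "HOL-Library.Extended_Nat" "HOL-Library.Extended_Real"
begin

(* The index p plays the role of the first coordinate; the remaining
   CARD('n) - 1 coordinates enter linearly. *)
definition abs_lin :: "real \<Rightarrow> 'n \<Rightarrow> real ^ 'n \<Rightarrow> real" where
  "abs_lin a p x = a * \<bar>x $ p\<bar> + (\<Sum>i \<in> UNIV - {p}. x $ i)"

(* Meaningful only where f is differentiable; elsewhere the value is unspecified. *)
definition grad :: "(real ^ 'n \<Rightarrow> real) \<Rightarrow> real ^ 'n \<Rightarrow> real ^ 'n" where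
  "grad f x = (THE g. GDERIV f x :> g)"

definition armijo ::
    "(real ^ 'n \<Rightarrow> real) \<Rightarrow> real \<Rightarrow> real ^ 'n \<Rightarrow> real ^ 'n \<Rightarrow> real \<Rightarrow> bool" where
  "armijo f c1 x d t \<longleftrightarrow> f (x + t *\<^sub>R d) \<le> f x + c1 * t * (grad f x \<bullet> d)"

definition wolfe ::
    "(real ^ 'n \<Rightarrow> real) \<Rightarrow> real \<Rightarrow> real ^ 'n \<Rightarrow> real ^ 'n \<Rightarrow> real \<Rightarrow> bool" where
  "wolfe f c2 x d t \<longleftrightarrow>
     f differentiable (at (x + t *\<^sub>R d)) \<and>
     grad f (x + t *\<^sub>R d) \<bullet> d \<ge> c2 * (grad f x \<bullet> d)"

definition armijo_wolfe ::
    "(real ^ 'n \<Rightarrow> real) \<Rightarrow> real \<Rightarrow> real \<Rightarrow> real ^ 'n \<Rightarrow> real ^ 'n \<Rightarrow> real \<Rightarrow> bool" where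
  "armijo_wolfe f c1 c2 x d t \<longleftrightarrow> t > 0 \<and> armijo f c1 x d t \<and> wolfe f c2 x d t"

definition outer :: "real ^ 'n \<Rightarrow> real ^ 'n \<Rightarrow> real ^ 'n ^ 'n" where
  "outer u v = (\<chi> i j. u $ i * v $ j)"

definition scale_factor :: "real ^ 'n \<Rightarrow> real ^ 'n \<Rightarrow> real" where
  "scale_factor s y = (s \<bullet> y) / (y \<bullet> y)"

definition bfgs_V :: "real ^ 'n \<Rightarrow> real ^ 'n \<Rightarrow> real ^ 'n ^ 'n" where
  "bfgs_V s y = mat 1 - (1 / (y \<bullet> s)) *\<^sub>R outer y s"

definition bfgs_H :: "real ^ 'n \<Rightarrow> real ^ 'n \<Rightarrow> real ^ 'n ^ 'n" where
  "bfgs_H s y =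
     scale_factor s y *\<^sub>R (transpose (bfgs_V s y) ** bfgs_V s y)
     + (1 / (s \<bullet> y)) *\<^sub>R outer s s"

definition step_s :: "(nat \<Rightarrow> real ^ 'n) \<Rightarrow> nat \<Rightarrow> real ^ 'n" where
  "step_s x k = x (Suc k) - x k"

definition step_y :: "(real ^ 'n \<Rightarrow> real) \<Rightarrow> (nat \<Rightarrow> real ^ 'n) \<Rightarrow> nat \<Rightarrow> real ^ 'n" where
  "step_y f x k = grad f (x (Suc k)) - grad f (x k)"

(* A run performing K steps, where K may be infinite.  If K is finite, the run
   stops at x K because no Armijo-Wolfe steplength exists there, and the
   values of x and d beyond index K, and of t from index K on, are irrelevant.
   Leaving t k unconstrained apart from the two conditions accounts for every
   Armijo-Wolfe line search. *)
definition smbfgs_run ::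
    "(real ^ 'n \<Rightarrow> real) \<Rightarrow> real \<Rightarrow> real \<Rightarrow> real ^ 'n \<Rightarrow> enat \<Rightarrow>
     (nat \<Rightarrow> real ^ 'n) \<Rightarrow> (nat \<Rightarrow> real ^ 'n) \<Rightarrow> (nat \<Rightarrow> real) \<Rightarrow> bool" where
  "smbfgs_run f c1 c2 x0 K x d t \<longleftrightarrow>
     x 0 = x0 \<and>
     d 0 = - grad f x0 \<and>
     (\<forall>k. enat k < K \<longrightarrow>
        armijo_wolfe f c1 c2 (x k) (d k) (t k) \<and>
        x (Suc k) = x k + t k *\<^sub>R d k \<and>
        d (Suc k) = - (bfgs_H (step_s x k) (step_y f x k) *v grad f (x (Suc k)))) \<and>
     (\<forall>k. K = enat k \<longrightarrow> \<not> (\<exists>\<tau>. armijo_wolfe f c1 c2 (x k) (d k) \<tau>))"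

(* The states (alpha, beta, t) visited by the bracketing line search. *)
inductive bracketing_state ::
    "(real ^ 'n \<Rightarrow> real) \<Rightarrow> real \<Rightarrow> real \<Rightarrow> real ^ 'n \<Rightarrow> real ^ 'n \<Rightarrow>
     real \<Rightarrow> ereal \<Rightarrow> real \<Rightarrow> bool"
  for f c1 c2 x d where
  start: "bracketing_state f c1 c2 x d 0 \<infinity> 1"
| step: "bracketing_state f c1 c2 x d \<alpha>' \<beta>' (if \<beta>' < \<infinity> then (\<alpha>' + real_of_ereal \<beta>') / 2 else 2 * \<alpha>')"
    if "bracketing_state f c1 c2 x d \<alpha> \<beta> t"
      and "\<not> (armijo f c1 x d t \<and> wolfe f c2 x d t)"
      and "\<alpha>' = (if armijo f c1 x d t then t else \<alpha>)"
      and "\<beta>' = (if armijo f c1 x d t then \<beta> else ereal t)"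

definition bracketing_returns ::
    "(real ^ 'n \<Rightarrow> real) \<Rightarrow> real \<Rightarrow> real \<Rightarrow> real ^ 'n \<Rightarrow> real ^ 'n \<Rightarrow> real \<Rightarrow> bool" where
  "bracketing_returns f c1 c2 x d t \<longleftrightarrow>
     (\<exists>\<alpha> \<beta>. bracketing_state f c1 c2 x d \<alpha> \<beta> t) \<and> armijo f c1 x d t \<and> wolfe f c2 x d t"

end

theory Submission
  imports Defs
begin

text \<open>
  Write \<open>m = n - 1\<close>. The Wolfe condition forces the first coordinate to change sign at every step,
  so \<open>y\<close> is a multiple of the first unit vector and every direction has the form
  \<open>d = (\<mp>e, -r e, \<dots>, -r e)\<close> with \<open>e > 0\<close>. The slope \<open>r\<close> evolves independently of the line search,
  by \<open>r \<mapsto> (1 - a r + 2 m r\<^sup>2) / (a - m r)\<close> from \<open>r = 1 / a\<close>; this map contracts \<open>[0, 1 / a]\<close>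
  towards its fixed point \<open>b\<close>. With \<open>l = t e\<close> and \<open>l'\<close> the same quantity one step later, the Armijo
  condition at two consecutive steps gives
  \<open>l' (2 a - (1 - c1) (a + m r')) \<le> (1 - c1) (a + m r) l\<close>, while \<open>t \<le> 2\<close> gives
  \<open>l' \<le> (1 - m r / a) l\<close>. As \<open>r \<rightarrow> b\<close>, either alternative bounds \<open>l' / l\<close> in the limit by a
  constant below 1, so the step lengths are summable.
\<close>

section \<open>Vectors that are constant off one coordinate\<close>

text \<open>By symmetry in the coordinates other than \<open>p\<close>, every gradient, step and
  search direction of the method lies in this two-parameter family; the iterates themselves need
  not.\<close>

definition spike :: "'n \<Rightarrow> real \<Rightarrow> real \<Rightarrow> real ^ 'n" where
  "spike p s c = (\<chi> i. if i = p then s else c)"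

lemma spike_nth: "spike p s c $ i = (if i = p then s else c)"
  by (simp add: spike_def)

lemma spike_nth_same [simp]: "spike p s c $ p = s"
  by (simp add: spike_nth)

lemma spike_add: "spike p s c + spike p s' c' = spike p (s + s') (c + c')"
  by (simp add: vec_eq_iff spike_nth)

lemma spike_diff: "spike p s c - spike p s' c' = spike p (s - s') (c - c')"
  by (simp add: vec_eq_iff spike_nth)

lemma spike_minus: "- spike p s c = spike p (- s) (- c)"
  by (simp add: vec_eq_iff spike_nth)

lemma spike_scaleR: "k *\<^sub>R spike p s c = spike p (k * s) (k * c)"
  by (simp add: vec_eq_iff spike_nth)

lemma abs_minus_sgn_mult:
  fixes x e :: real
  assumes "x \<noteq> 0" "0 \<le> e"
  shows "\<bar>- sgn x * e\<bar> = e"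
  using assms by (simp add: abs_mult abs_sgn_eq)

lemma real_card_Compl1: "real (card (UNIV - {p :: 'n :: finite})) = real CARD('n) - 1"
  by (simp add: card_Diff_singleton Suc_leI of_nat_diff)

lemma inner_spike:
  "spike p s c \<bullet> spike (p :: 'n :: finite) s' c' = s * s' + (real CARD('n) - 1) * (c * c')"
proof -
  have "spike p s c \<bullet> spike p s' c' = s * s' + (\<Sum>i\<in>UNIV - {p}. c * c')"
    unfolding inner_vec_def by (subst sum.remove[of _ p]) (auto simp: spike_nth intro!: sum.cong)
  then show ?thesis by (simp add: real_card_Compl1)
qed

lemma sum_Compl1_spike:
  "(\<Sum>i\<in>UNIV - {p}. spike (p :: 'n :: finite) s c $ i) = (real CARD('n) - 1) * c"
proof -
  have "(\<Sum>i\<in>UNIV - {p}. spike p s c $ i) = (\<Sum>i\<in>UNIV - {p}. c)"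
    by (rule sum.cong) (auto simp: spike_nth)
  then show ?thesis by (simp add: real_card_Compl1)
qed

lemma abs_lin_add_spike:
  "abs_lin a p (x + spike (p :: 'n :: finite) s c) =
     abs_lin a p x + a * (\<bar>x $ p + s\<bar> - \<bar>x $ p\<bar>) + (real CARD('n) - 1) * c"
  by (simp add: abs_lin_def sum.distrib sum_Compl1_spike algebra_simps)

section \<open>Gradient and differentiability of the objective\<close>

text \<open>On the open half-space where coordinate \<open>p\<close> keeps the sign it has at
  \<open>x\<close>, the objective coincides with a linear function.\<close>

lemma GDERIV_abs_lin:
  fixes x :: "real ^ 'n :: finite"
  assumes "x $ p \<noteq> 0"
  shows "GDERIV (abs_lin a p) x :> spike p (a * sgn (x $ p)) 1"
  unfolding gderiv_def
proof (rule has_derivative_transform_within_open)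
  let ?g = "\<lambda>z :: real ^ 'n. a * (sgn (x $ p) * z $ p) + (\<Sum>i\<in>UNIV - {p}. z $ i)"
  let ?S = "{z :: real ^ 'n. 0 < sgn (x $ p) * z $ p}"
  have "h \<bullet> spike p (a * sgn (x $ p)) 1 = ?g h" for h
    unfolding inner_vec_def
    by (subst sum.remove[of _ p]) (auto simp: spike_nth mult_ac intro!: sum.cong)
  then show "(?g has_derivative (\<lambda>h. h \<bullet> spike p (a * sgn (x $ p)) 1)) (at x)"
    by (auto intro!: derivative_eq_intros
        bounded_linear_imp_has_derivative[OF bounded_linear_vec_nth])
  show "open ?S"
    by (intro open_Collect_less continuous_intros)
  show "x \<in> ?S" using assms by (simp add: sgn_if)
  fix z assume "z \<in> ?S"
  then show "?g z = abs_lin a p z"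
    by (auto simp: abs_lin_def sgn_if split: if_splits)
qed

lemma grad_abs_lin:
  fixes x :: "real ^ 'n :: finite"
  assumes "x $ p \<noteq> 0"
  shows "grad (abs_lin a p) x = spike p (a * sgn (x $ p)) 1"
  unfolding grad_def
proof (rule the_equality)
  show "GDERIV (abs_lin a p) x :> spike p (a * sgn (x $ p)) 1"
    by (rule GDERIV_abs_lin[OF assms])
next
  fix g assume "GDERIV (abs_lin a p) x :> g"
  then have "(\<lambda>h. h \<bullet> g) = (\<lambda>h. h \<bullet> spike p (a * sgn (x $ p)) 1)"
    using GDERIV_abs_lin[OF assms] unfolding gderiv_def by (rule has_derivative_unique)
  then show "g = spike p (a * sgn (x $ p)) 1"
    by (metis vector_eq_ldot)
qed

lemma abs_lin_differentiable_iff: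
  fixes x :: "real ^ 'n :: finite"
  assumes "a > 0"
  shows "abs_lin a p differentiable (at x) \<longleftrightarrow> x $ p \<noteq> 0"
proof
  assume "x $ p \<noteq> 0"
  then show "abs_lin a p differentiable (at x)"
    using GDERIV_abs_lin unfolding gderiv_def differentiable_def by blast
next
  assume diff: "abs_lin a p differentiable (at x)"
  show "x $ p \<noteq> 0"
  proof
    assume x: "x $ p = 0"
    \<comment> \<open>Along coordinate \<open>p\<close> the objective is a constant plus
      \<open>a * \<bar>s\<bar>\<close>. Both this and its tilt by \<open>- a * s\<close> are minimal
      at 0, so a derivative would have to equal 0 and \<open>a\<close> at once.\<close>
    let ?g = "\<lambda>s. abs_lin a p (x + s *\<^sub>R spike p 1 0)"
    have g: "?g s = abs_lin a p x + a * \<bar>s\<bar>" for s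
      by (simp add: spike_scaleR abs_lin_add_spike x)
    have "?g differentiable (at 0)"
      by (rule differentiable_compose[of "abs_lin a p"]) (use diff in auto)
    then obtain D where D: "(?g has_real_derivative D) (at 0)"
      by (auto simp: real_differentiable_def)
    have "D = 0"
      by (rule DERIV_local_min[OF D, of 1]) (use assms g in auto)
    moreover have "((\<lambda>s. ?g s - a * s) has_real_derivative D - a) (at 0)"
      by (auto intro!: derivative_eq_intros D)
    from DERIV_local_min[OF this, of 1] have "D - a = 0"
      using assms g by (auto simp: abs_ge_self)
    ultimately show False using assms by simp
  qed
qed

section \<open>The BFGS update applied to such vectors\<close>

lemma outer_mult_vec: "outer u v *v w = (v \<bullet> w) *\<^sub>R u"
  by (simp add: vec_eq_iff outer_def matrix_vector_mult_def inner_vec_def sum_distrib_left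
      sum_distrib_right mult_ac)

lemma bfgs_V_mult_vec: "bfgs_V s y *v w = w - ((s \<bullet> w) / (y \<bullet> s)) *\<^sub>R y"
  by (simp add: bfgs_V_def matrix_vector_mult_diff_rdistrib outer_mult_vec
      scaleR_matrix_vector_assoc[symmetric])

lemma transpose_bfgs_V_mult_vec: "transpose (bfgs_V s y) *v w = w - ((y \<bullet> w) / (y \<bullet> s)) *\<^sub>R s"
proof -
  have "transpose (bfgs_V s y) = mat 1 - (1 / (y \<bullet> s)) *\<^sub>R outer s y"
    by (simp add: vec_eq_iff bfgs_V_def outer_def transpose_def mat_def mult_ac)
  then show ?thesis
    by (simp add: matrix_vector_mult_diff_rdistrib outer_mult_vec
      scaleR_matrix_vector_assoc[symmetric])
qed

lemma bfgs_H_mult_vec: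
  "bfgs_H s y *v g =
     scale_factor s y *\<^sub>R (transpose (bfgs_V s y) *v (bfgs_V s y *v g)) + ((s \<bullet> g) / (s \<bullet> y)) *\<^sub>R s"
  by (simp add: bfgs_H_def matrix_vector_mult_add_rdistrib outer_mult_vec
      scaleR_matrix_vector_assoc[symmetric] matrix_vector_mul_assoc)

text \<open>Here \<open>\<tau>\<close> is the sign of the new first coordinate and the scale factor
  is \<open>l / (2 * a)\<close>. The term with \<open>V\<close> has zero entry at \<open>p\<close>,
  so that entry comes from the rank-one term alone; off \<open>p\<close> the two terms contribute
  \<open>1 + m * r\<^sup>2\<close> and \<open>- r * (a - m * r)\<close>, up to the factor
  \<open>l / (2 * a)\<close>.\<close>

lemma bfgs_H_spike:
  fixes p :: "'n :: finite"
  assumes "\<bar>\<tau>\<bar> = 1" "l > 0" "a > 0"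
  defines "m \<equiv> real CARD('n) - 1"
  shows "bfgs_H (spike p (\<tau> * l) (- (r * l))) (spike p (2 * a * \<tau>) 0) *v spike p (a * \<tau>) 1 =
    spike p (\<tau> * (l / (2 * a) * (a - m * r))) (l / (2 * a) * (1 - a * r + 2 * m * r\<^sup>2))"
proof -
  have "\<tau> = 1 \<or> \<tau> = -1" using assms(1) by auto
  then show ?thesis
    unfolding bfgs_H_mult_vec bfgs_V_mult_vec transpose_bfgs_V_mult_vec scale_factor_def
      inner_spike spike_scaleR spike_add spike_diff m_def[symmetric]
    using \<open>l > 0\<close> \<open>a > 0\<close>
    by (intro arg_cong2[where f = "spike p"]; elim disjE)
      (simp_all add: field_simps power2_eq_square)
qed


section \<open>The constants and the slope recurrence\<close>

locale smbfgs_abs_lin =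
  fixes a b c1 c2 m :: real and p :: "'n :: finite"
  assumes m_eq: "m = real CARD('n) - 1" and m_ge: "m \<ge> 1"
    and a_ge: "a \<ge> 2 * sqrt m"
    and b_eq: "b = (a - sqrt (a\<^sup>2 - 3 * m)) / (3 * m)"
    and c1_pos: "0 < c1" and c1_less: "c1 < c2" and c2_less: "c2 < 1"
begin

lemma a_pos: "a > 0"
  using a_ge m_ge real_sqrt_gt_zero[of m] by linarith

lemma four_m_le: "4 * m \<le> a\<^sup>2"
proof -
  have "(2 * sqrt m)\<^sup>2 \<le> a\<^sup>2"
    by (rule power_mono) (use a_ge m_ge in auto)
  then show ?thesis using m_ge by (simp add: power_mult_distrib)
qed

text \<open>\<open>b\<close> is the smaller root of the fixed-point equation of
  \<open>slope_map\<close>. Both estimates compare \<open>s\<close> with \<open>a\<close>: the bound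
  \<open>4 * m \<le> a\<^sup>2\<close> gives \<open>a / 2 \<le> s\<close>, and
  \<open>s \<le> a\<close> is clear.\<close>

lemma b_facts:
  shows b_root: "3 * m * b\<^sup>2 - 2 * a * b + 1 = 0"
    and b_lower: "1 / (2 * a) \<le> b"
    and b_upper: "3 * m * b \<le> a / 2"
proof -
  define s where "s = sqrt (a\<^sup>2 - 3 * m)"
  have s2: "s\<^sup>2 = a\<^sup>2 - 3 * m" and s0: "s \<ge> 0"
    using four_m_le m_ge by (auto simp: s_def)
  have mb: "3 * m * b = a - s"
    using m_ge by (simp add: b_eq s_def)
  have "(a / 2)\<^sup>2 \<le> s\<^sup>2"
    using four_m_le by (simp add: s2 power_divide)
  then have "a / 2 \<le> s" using s0 by (rule power2_le_imp_le)
  then show "3 * m * b \<le> a / 2" using mb by linarith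
  \<comment> \<open>Rationalising the numerator yields \<open>b = 1 / (a + s)\<close>, which gives
    the lower bound and the quadratic equation.\<close>
  have "3 * m * (b * (a + s)) = (a - s) * (a + s)" using mb by (metis mult.assoc)
  also have "\<dots> = 3 * m" using s2 by (simp add: algebra_simps power2_eq_square)
  finally have bs: "b * (a + s) = 1" using m_ge by simp
  have "s\<^sup>2 \<le> a\<^sup>2" using s2 m_ge by linarith
  then have sa: "s \<le> a" using a_pos power2_le_imp_le by (meson less_imp_le)
  have "1 / (2 * a) \<le> 1 / (a + s)"
    using sa s0 a_pos by (intro divide_left_mono) auto
  also have "1 / (a + s) = b"
    using bs s0 a_pos by (simp add: field_simps)
  finally show "1 / (2 * a) \<le> b" .
  have "3 * m * b\<^sup>2 - 2 * a * b + 1 = (3 * m * b) * b - 2 * a * b + b * (a + s)"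
    by (simp add: bs power2_eq_square)
  also have "\<dots> = 0" unfolding mb by (simp add: algebra_simps)
  finally show "3 * m * b\<^sup>2 - 2 * a * b + 1 = 0" .
qed

lemma b_pos: "b > 0"
  using b_lower a_pos by (meson divide_pos_pos less_le_trans mult_pos_pos zero_less_numeral zero_less_one)

lemma m_mult_le:
  assumes "r \<le> 1 / a"
  shows "m * r \<le> a / 4"
proof -
  have "m * r \<le> m * (1 / a)" using assms m_ge by (intro mult_left_mono) auto
  also have "\<dots> \<le> a / 4" using four_m_le a_pos by (simp add: field_simps power2_eq_square)
  finally show ?thesis .
qed

text \<open>The ratio of the two entries computed in \<open>bfgs_H_spike\<close>.\<close>

definition slope_map :: "real \<Rightarrow> real" where
  "slope_map r = (1 - a * r + 2 * m * r\<^sup>2) / (a - m * r)"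

text \<open>Eliminating the constant 1 by \<open>b_root\<close> exposes the factor
  \<open>r - b\<close>. The remaining quotient lies in (-1, 0], so the slopes move to the other side
  of \<open>b\<close> or onto it.\<close>

lemma slope_map_contraction:
  assumes "0 \<le> r" "r \<le> 1 / a"
  shows "\<bar>slope_map r - b\<bar> \<le> (1 - 3 * m * b / a) * \<bar>r - b\<bar>"
proof -
  have mr: "0 \<le> m * r" "m * r \<le> a / 4"
    using assms m_mult_le m_ge by auto
  then have pos: "a - m * r > 0" using a_pos by linarith
  have "1 - a * r + 2 * m * r\<^sup>2 - b * (a - m * r) = (r - b) * (2 * (m * r) + 3 * m * b - a)"
    using b_root by (simp add: algebra_simps power2_eq_square)
  then have eq: "slope_map r - b = (r - b) * ((2 * (m * r) + 3 * m * b - a) / (a - m * r))"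
    using pos by (simp add: slope_map_def field_simps)
  let ?q = "(2 * (m * r) + 3 * m * b - a) / (a - m * r)"
  \<comment> \<open>Each of the two positive terms is at most \<open>a / 2\<close>.\<close>
  have "2 * (m * r) + 3 * m * b - a \<le> 0" using mr b_upper by linarith
  then have "\<bar>?q\<bar> = (a - 2 * (m * r) - 3 * m * b) / (a - m * r)"
    using pos by (simp add: abs_divide)
  also have "\<dots> = 1 - (m * r + 3 * m * b) / (a - m * r)"
    using pos by (simp add: field_simps)
  also have "\<dots> \<le> 1 - 3 * m * b / a"
  proof -
    have "3 * m * b / a \<le> (m * r + 3 * m * b) / (a - m * r)"
      using mr pos b_pos m_ge by (intro frac_le) auto
    then show ?thesis by linarith
  qed
  finally show ?thesis unfolding eq abs_mult
    by (metis abs_ge_zero mult.commute mult_right_mono)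
qed

text \<open>The start \<open>1 / a\<close> is the slope of \<open>d 0 = - grad f x0\<close>, whose
  entries have absolute value \<open>a\<close> at \<open>p\<close> and 1 elsewhere.\<close>

definition slope :: "nat \<Rightarrow> real" where
  "slope k = (slope_map ^^ k) (1 / a)"

lemma slope_0: "slope 0 = 1 / a" and slope_Suc: "slope (Suc k) = slope_map (slope k)"
  by (simp_all add: slope_def)

lemma contraction_factor: "0 < 1 - 3 * m * b / a" "1 - 3 * m * b / a < 1"
  using b_upper a_pos b_pos m_ge by (auto simp: field_simps)

text \<open>The contraction is available only on \<open>[0, 1 / a]\<close>, so the range is proved
  along with the distance. The interval of radius \<open>1 / a - b\<close> around \<open>b\<close>
  stays inside because \<open>1 / a \<le> 2 * b\<close>.\<close>

lemma slope_dist: "\<bar>slope k - b\<bar> \<le> (1 - 3 * m * b / a) ^ k * (1 / a - b) \<and> 0 \<le> slope k \<and> slope k \<le> 1 / a"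
proof -
  have b1: "0 \<le> 1 / a - b" "1 / a - b \<le> b"
  proof -
    have "3 * b \<le> 3 * m * b" using m_ge b_pos by simp
    \<comment> \<open>By \<open>b_root\<close>, the estimate below reads
      \<open>2 * a * b - 1 \<le> a * b / 2\<close>.\<close>
    have "b * (3 * a) \<le> 2"
    proof -
      have "b * (3 * m * b) \<le> b * (a / 2)"
        using b_upper b_pos by (intro mult_left_mono) auto
      then show ?thesis using b_root by (simp add: algebra_simps power2_eq_square)
    qed
    then show "0 \<le> 1 / a - b" using a_pos by (simp add: field_simps)
    show "1 / a - b \<le> b" using b_lower by simp
  qed
  have bound: "0 \<le> slope k \<and> slope k \<le> 1 / a"
    if "\<bar>slope k - b\<bar> \<le> (1 - 3 * m * b / a) ^ k * (1 / a - b)" for k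
  proof -
    note that
    also have "(1 - 3 * m * b / a) ^ k * (1 / a - b) \<le> 1 * (1 / a - b)"
      using contraction_factor b1 by (intro mult_right_mono power_le_one) auto
    finally have "\<bar>slope k - b\<bar> \<le> 1 / a - b" by simp
    then show ?thesis using b1 by (simp add: abs_le_iff)
  qed
  have "\<bar>slope k - b\<bar> \<le> (1 - 3 * m * b / a) ^ k * (1 / a - b)"
  proof (induction k)
    case 0
    then show ?case using b1 by (simp add: slope_0)
  next
    case (Suc k)
    have "\<bar>slope (Suc k) - b\<bar> \<le> (1 - 3 * m * b / a) * \<bar>slope k - b\<bar>"
      unfolding slope_Suc using bound[OF Suc] by (intro slope_map_contraction) auto
    also have "\<dots> \<le> (1 - 3 * m * b / a) * ((1 - 3 * m * b / a) ^ k * (1 / a - b))"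
      using contraction_factor Suc by (intro mult_left_mono) auto
    finally show ?case by (simp add: mult_ac)
  qed
  then show ?thesis using bound by blast
qed

lemma slope_nonneg: "0 \<le> slope k" and slope_le: "slope k \<le> 1 / a"
  using slope_dist by blast+

lemma slope_tendsto: "slope \<longlonglongrightarrow> b"
proof -
  have "(\<lambda>k. (1 - 3 * m * b / a) ^ k * (1 / a - b)) \<longlonglongrightarrow> 0"
    using contraction_factor by (intro tendsto_mult_left_zero LIMSEQ_power_zero) auto
  then have "(\<lambda>k. slope k - b) \<longlonglongrightarrow> 0"
    by (rule Lim_null_comparison[rotated]) (use slope_dist in auto)
  then show ?thesis by (simp add: LIM_zero_iff)
qed

lemma m_slope_le: "m * slope k \<le> a / 4"
  by (rule m_mult_le[OF slope_le])

section \<open>Line search conditions along the search directions\<close>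

text \<open>The directional derivative keeps its initial value before the kink, which fails Wolfe
  since \<open>c2 < 1\<close>; at the kink the gradient does not exist; beyond it the derivative is
  \<open>e * (a - m * r) > 0\<close>.\<close>

lemma wolfe_iff:
  fixes x :: "real ^ 'n"
  assumes x: "x $ p \<noteq> 0" and e: "e > 0" and r: "0 \<le> r" "r \<le> 1 / a"
    and d: "d = spike p (- sgn (x $ p) * e) (- (r * e))" and t: "t > 0"
  shows "wolfe (abs_lin a p) c2 x d t \<longleftrightarrow> \<bar>x $ p\<bar> < t * e"
proof -
  have mr: "0 \<le> m * r" "m * r \<le> a / 4" using r m_mult_le m_ge by auto
  have gd: "grad (abs_lin a p) x \<bullet> d = - (e * (a + m * r))"
    using x by (simp add: grad_abs_lin d inner_spike m_eq[symmetric] sgn_if algebra_simps)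
  have x': "(x + t *\<^sub>R d) $ p = sgn (x $ p) * (\<bar>x $ p\<bar> - t * e)"
    using x by (simp add: d sgn_if algebra_simps)
  have pos: "0 < e * (a + m * r)" "0 < e * (a - m * r)"
    using e mr a_pos by auto
  have c2: "c2 * - (e * (a + m * r)) < 0" "- (e * (a + m * r)) < c2 * - (e * (a + m * r))"
    using pos c1_pos c1_less c2_less mult_strict_right_mono[OF c2_less pos(1)]
    by (auto simp: mult_less_0_iff)
  consider "t * e < \<bar>x $ p\<bar>" | "t * e = \<bar>x $ p\<bar>" | "\<bar>x $ p\<bar> < t * e" by linarith
  then show ?thesis
  proof cases
    case 1
    then have s: "sgn ((x + t *\<^sub>R d) $ p) = sgn (x $ p)" "(x + t *\<^sub>R d) $ p \<noteq> 0"
      using x unfolding x' by (auto simp: sgn_mult sgn_0_0)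
    have same: "grad (abs_lin a p) (x + t *\<^sub>R d) = grad (abs_lin a p) x"
      using s x by (simp add: grad_abs_lin)
    show ?thesis using 1 c2 unfolding wolfe_def same gd by auto
  next
    case 2
    then have "(x + t *\<^sub>R d) $ p = 0" unfolding x' by simp
    then have "\<not> abs_lin a p differentiable (at (x + t *\<^sub>R d))"
      unfolding abs_lin_differentiable_iff[OF a_pos] by blast
    then show ?thesis using 2 unfolding wolfe_def by simp
  next
    case 3
    then have s: "sgn ((x + t *\<^sub>R d) $ p) = - sgn (x $ p)" "(x + t *\<^sub>R d) $ p \<noteq> 0"
      using x unfolding x' by (auto simp: sgn_mult sgn_0_0)
    have "grad (abs_lin a p) (x + t *\<^sub>R d) = spike p (- (a * sgn (x $ p))) 1"
      using grad_abs_lin[OF s(2)] s(1) by simp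
    then have "grad (abs_lin a p) (x + t *\<^sub>R d) \<bullet> d = e * (a - m * r)"
      using x by (simp add: d inner_spike m_eq[symmetric] sgn_if algebra_simps)
    then show ?thesis
      using 3 c2 pos s(2) unfolding wolfe_def gd abs_lin_differentiable_iff[OF a_pos] by auto
  qed
qed

lemma armijo_iff:
  fixes x :: "real ^ 'n"
  assumes x: "x $ p \<noteq> 0" and cross: "\<bar>x $ p\<bar> < t * e"
    and d: "d = spike p (- sgn (x $ p) * e) (- (r * e))"
  shows "armijo (abs_lin a p) c1 x d t \<longleftrightarrow> t * e * (2 * a - (1 - c1) * (a + m * r)) \<le> 2 * a * \<bar>x $ p\<bar>"
proof -
  have gd: "grad (abs_lin a p) x \<bullet> d = - (e * (a + m * r))"
    using x by (simp add: grad_abs_lin d inner_spike m_eq[symmetric] sgn_if algebra_simps)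
  have jump: "\<bar>x $ p + t * (- sgn (x $ p) * e)\<bar> = t * e - \<bar>x $ p\<bar>"
    using x cross by (auto simp: sgn_if abs_if)
  have f': "abs_lin a p (x + t *\<^sub>R d) = abs_lin a p x + a * (t * e - 2 * \<bar>x $ p\<bar>) - m * (t * (r * e))"
    by (simp only: d spike_scaleR abs_lin_add_spike m_eq[symmetric] jump) (simp add: algebra_simps)
  show ?thesis unfolding armijo_def gd f' by (simp add: algebra_simps)
qed

lemma armijo_wolfe_iff:
  fixes x :: "real ^ 'n"
  assumes "x $ p \<noteq> 0" "e > 0" "0 \<le> r" "r \<le> 1 / a"
    and "d = spike p (- sgn (x $ p) * e) (- (r * e))"
  shows "armijo_wolfe (abs_lin a p) c1 c2 x d t \<longleftrightarrow>
    t > 0 \<and> \<bar>x $ p\<bar> < t * e \<and> t * e * (2 * a - (1 - c1) * (a + m * r)) \<le> 2 * a * \<bar>x $ p\<bar>"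
  using wolfe_iff[OF assms] armijo_iff[OF assms(1) _ assms(5)] unfolding armijo_wolfe_def by blast

text \<open>The bound \<open>5 * a / 4\<close> makes the Armijo coefficient positive here and lets a
  step of 2 cross the kink in \<open>wolfe_2\<close>.\<close>

lemma armijo_coeff:
  assumes "0 \<le> r" "r \<le> 1 / a"
  shows "0 < (1 - c1) * (a + m * r)" "(1 - c1) * (a + m * r) < a + a / 4"
proof -
  have mr: "0 \<le> m * r" "m * r \<le> a / 4" using assms m_mult_le m_ge by auto
  show "0 < (1 - c1) * (a + m * r)" using mr a_pos c1_less c2_less by auto
  have "(1 - c1) * (a + m * r) < a + m * r"
    using mult_strict_right_mono[of "1 - c1" 1 "a + m * r"] mr a_pos c1_pos by auto
  then show "(1 - c1) * (a + m * r) < a + a / 4" using mr by linarith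
qed

lemma armijo_wolfe_exists:
  fixes x :: "real ^ 'n"
  assumes "x $ p \<noteq> 0" "e > 0" "0 \<le> r" "r \<le> 1 / a"
    and "d = spike p (- sgn (x $ p) * e) (- (r * e))"
  shows "\<exists>\<tau>. armijo_wolfe (abs_lin a p) c1 c2 x d \<tau>"
proof -
  define q where "q = 2 * a - (1 - c1) * (a + m * r)"
  have q: "0 < q" "q < 2 * a"
    using armijo_coeff[OF assms(3,4)] a_pos by (auto simp: q_def)
  \<comment> \<open>This steplength makes the Armijo inequality an equality;
    \<open>q < 2 * a\<close> puts it beyond the kink.\<close>
  define \<tau> where "\<tau> = 2 * a * \<bar>x $ p\<bar> / q / e"
  have te: "\<tau> * e = 2 * a * \<bar>x $ p\<bar> / q" using assms(2) by (simp add: \<tau>_def)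
  have "\<tau> > 0" using q a_pos assms by (simp add: \<tau>_def)
  moreover have "\<bar>x $ p\<bar> < \<tau> * e"
    unfolding te using q assms(1) by (simp add: pos_less_divide_eq mult.commute)
  moreover have "\<tau> * e * q \<le> 2 * a * \<bar>x $ p\<bar>"
    unfolding te using q by simp
  ultimately show ?thesis
    using armijo_wolfe_iff[OF assms] unfolding q_def by blast
qed

section \<open>One step of the method, and the bracketing search\<close>

text \<open>Crossing the kink flips only the \<open>p\<close> entry of the gradient, so
  \<open>y\<close> is supported on \<open>p\<close> and \<open>bfgs_H_spike\<close> applies. The new
  direction has the same shape as \<open>d\<close>, so the computation can be iterated.\<close>

lemma bfgs_step:
  fixes x :: "real ^ 'n"
  assumes x: "x $ p \<noteq> 0" and e: "e > 0" and r: "0 \<le> r" "r \<le> 1 / a"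
    and d: "d = spike p (- sgn (x $ p) * e) (- (r * e))"
    and t: "t > 0" "\<bar>x $ p\<bar> < t * e"
    and x': "x' = x + t *\<^sub>R d"
    and y: "y = grad (abs_lin a p) x' - grad (abs_lin a p) x"
    and d': "d' = - (bfgs_H (x' - x) y *v grad (abs_lin a p) x')"
  shows "\<bar>x' $ p\<bar> = t * e - \<bar>x $ p\<bar>"
    and "d' = spike p (- sgn (x' $ p) * (t * e / (2 * a) * (a - m * r)))
               (- (slope_map r * (t * e / (2 * a) * (a - m * r))))"
    and "scale_factor (x' - x) y = \<bar>(x' - x) $ p\<bar> / (2 * a)"
proof -
  have xp: "x' $ p = - sgn (x $ p) * (t * e - \<bar>x $ p\<bar>)"
    using x by (simp add: x' d sgn_if algebra_simps)
  show "\<bar>x' $ p\<bar> = t * e - \<bar>x $ p\<bar>"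
    using x t unfolding xp by (simp add: abs_mult)
  define \<tau> where "\<tau> = - sgn (x $ p)"
  have \<tau>: "\<bar>\<tau>\<bar> = 1" using x by (simp add: \<tau>_def sgn_if)
  have s': "sgn (x' $ p) = \<tau>" "x' $ p \<noteq> 0"
    using x t unfolding xp by (auto simp: sgn_mult \<tau>_def sgn_0_0)
  have g: "grad (abs_lin a p) x' = spike p (a * \<tau>) 1"
    using s' by (simp add: grad_abs_lin)
  have y': "y = spike p (2 * a * \<tau>) 0"
    using x unfolding y g by (simp add: grad_abs_lin spike_diff \<tau>_def mult.assoc)
  have s: "x' - x = spike p (\<tau> * (t * e)) (- (r * (t * e)))"
    by (simp add: x' d spike_scaleR \<tau>_def mult_ac)
  have te: "t * e > 0" using t e by simp
  have amr: "a - m * r > 0" using m_mult_le[OF r(2)] a_pos by linarith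
  show "d' = spike p (- sgn (x' $ p) * (t * e / (2 * a) * (a - m * r)))
               (- (slope_map r * (t * e / (2 * a) * (a - m * r))))"
    unfolding d' y' s g s' bfgs_H_spike[OF \<tau> te a_pos] spike_minus m_eq[symmetric]
    using amr by (intro arg_cong2[where f = "spike p"]) (simp_all add: slope_map_def)
  have "\<tau> = 1 \<or> \<tau> = -1" using \<tau> by auto
  then show "scale_factor (x' - x) y = \<bar>(x' - x) $ p\<bar> / (2 * a)"
    unfolding scale_factor_def y' s inner_spike
    using te a_pos by (elim disjE) (simp_all add: field_simps)
qed

text \<open>If the Wolfe condition holds at 2, then the search never doubles beyond 2: a step rejected
  there must violate Armijo, which makes \<open>\<beta>\<close> finite.\<close>

lemma bracketing_le_2:
  fixes x :: "real ^ 'n"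
  assumes returns: "bracketing_returns (abs_lin a p) c1 c2 x d t"
    and w: "wolfe (abs_lin a p) c2 x d 2"
  shows "t \<le> 2"
proof -
  obtain \<alpha> \<beta> where "bracketing_state (abs_lin a p) c1 c2 x d \<alpha> \<beta> t"
    using returns unfolding bracketing_returns_def by blast
  then have "(\<beta> = \<infinity> \<and> (\<alpha> = 0 \<and> t = 1 \<or> \<alpha> = 1 \<and> t = 2)) \<or>
      (\<exists>B. \<beta> = ereal B \<and> \<alpha> \<le> 2 \<and> B \<le> 2 \<and> t \<le> 2)"
  proof (induction rule: bracketing_state.induct)
    case start
    then show ?case by simp
  next
    case (step \<alpha> \<beta> t \<alpha>' \<beta>')
    then show ?case using w by (auto split: if_splits)
  qed
  then show ?thesis by auto
qed

end

section \<open>Invariants of a run\<close>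

locale smbfgs_abs_lin_run = smbfgs_abs_lin a b c1 c2 m p
  for a b c1 c2 m :: real and p :: "'n :: finite" +
  fixes x0 :: "real ^ 'n" and K :: enat and x d :: "nat \<Rightarrow> real ^ 'n" and t :: "nat \<Rightarrow> real"
  assumes x0: "x0 $ p \<noteq> 0" and run: "smbfgs_run (abs_lin a p) c1 c2 x0 K x d t"
begin

lemma run_step:
  assumes "enat k < K"
  shows "armijo_wolfe (abs_lin a p) c1 c2 (x k) (d k) (t k)"
    and "x (Suc k) = x k + t k *\<^sub>R d k"
    and "d (Suc k) = - (bfgs_H (x (Suc k) - x k) (grad (abs_lin a p) (x (Suc k)) - grad (abs_lin a p) (x k))
          *v grad (abs_lin a p) (x (Suc k)))"
  using run assms unfolding smbfgs_run_def step_s_def step_y_def by auto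

text \<open>The range includes \<open>k = K\<close>: a finite run is refuted in
  \<open>K_infinite\<close> by finding a steplength at its last iterate.\<close>

lemma run_invariant:
  assumes "enat k \<le> K"
  shows "x k $ p \<noteq> 0 \<and> d k $ p \<noteq> 0 \<and>
    d k = spike p (- sgn (x k $ p) * \<bar>d k $ p\<bar>) (- (slope k * \<bar>d k $ p\<bar>))"
  using assms
proof (induction k)
  case 0
  have "x 0 = x0" "d 0 = - grad (abs_lin a p) x0"
    using run by (auto simp: smbfgs_run_def)
  then show ?case
    using x0 a_pos by (simp add: grad_abs_lin spike_minus slope_0 abs_mult abs_sgn_eq sgn_0_0 mult.commute)
next
  case (Suc k)
  let ?e = "\<bar>d k $ p\<bar>"
  let ?e' = "t k * ?e / (2 * a) * (a - m * slope k)"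
  have less: "enat k < K" using Suc.prems Suc_ile_eq by blast
  then have IH: "x k $ p \<noteq> 0" "0 < ?e"
      "d k = spike p (- sgn (x k $ p) * ?e) (- (slope k * ?e))"
    using Suc.IH by auto
  have aw: "t k > 0" "\<bar>x k $ p\<bar> < t k * ?e"
    using armijo_wolfe_iff[OF IH(1,2) slope_nonneg slope_le IH(3)] run_step(1)[OF less] by auto
  note step = bfgs_step[OF IH(1,2) slope_nonneg slope_le IH(3) aw run_step(2)[OF less] refl run_step(3)[OF less]]
  have nz: "x (Suc k) $ p \<noteq> 0" using step(1) aw by auto
  have pos: "?e' > 0"
    using aw IH(2) a_pos m_slope_le[of k] by (intro mult_pos_pos divide_pos_pos) auto
  then have "\<bar>d (Suc k) $ p\<bar> = ?e'"
    unfolding step(2) spike_nth_same by (intro abs_minus_sgn_mult[OF nz] less_imp_le)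
  then show ?case using nz step(2) pos by (auto simp: slope_Suc)
qed

lemma K_infinite: "K = \<infinity>"
proof (cases K)
  case (enat k)
  then have "x k $ p \<noteq> 0" "0 < \<bar>d k $ p\<bar>"
      "d k = spike p (- sgn (x k $ p) * \<bar>d k $ p\<bar>) (- (slope k * \<bar>d k $ p\<bar>))"
    using run_invariant[of k] by auto
  then have "\<exists>\<tau>. armijo_wolfe (abs_lin a p) c1 c2 (x k) (d k) \<tau>"
    by (rule armijo_wolfe_exists[OF _ _ slope_nonneg slope_le])
  then show ?thesis using run enat unfolding smbfgs_run_def by blast
qed

lemma enat_less_K: "enat k < K"
  by (simp add: K_infinite)

lemmas step_facts = run_step[OF enat_less_K]

lemma x_nz: "x k $ p \<noteq> 0" and d_pos: "0 < \<bar>d k $ p\<bar>"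
  and d_eq: "d k = spike p (- sgn (x k $ p) * \<bar>d k $ p\<bar>) (- (slope k * \<bar>d k $ p\<bar>))"
  using run_invariant[of k] K_infinite by auto

text \<open>The length of the step in coordinate \<open>p\<close>, hence \<open>2 * a\<close> times
  the scale factor.\<close>

definition len :: "nat \<Rightarrow> real" where
  "len k = t k * \<bar>d k $ p\<bar>"

lemma t_pos: "t k > 0" and x_less_len: "\<bar>x k $ p\<bar> < len k"
  and armijo_len: "len k * (2 * a - (1 - c1) * (a + m * slope k)) \<le> 2 * a * \<bar>x k $ p\<bar>"
  using armijo_wolfe_iff[OF x_nz d_pos slope_nonneg slope_le d_eq] step_facts(1)[of k]
  unfolding len_def by auto

lemmas run_bfgs_step = bfgs_step[OF x_nz d_pos slope_nonneg slope_le d_eq t_pos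
    x_less_len[unfolded len_def] step_facts(2) refl step_facts(3), folded len_def]

lemma x_Suc: "\<bar>x (Suc k) $ p\<bar> = len k - \<bar>x k $ p\<bar>"
  by (rule run_bfgs_step(1))

lemma d_Suc: "\<bar>d (Suc k) $ p\<bar> = len k / (2 * a) * (a - m * slope k)"
proof -
  have "len k / (2 * a) * (a - m * slope k) \<ge> 0"
    using t_pos[of k] d_pos[of k] a_pos m_slope_le[of k] by (simp add: len_def)
  then show ?thesis
    unfolding run_bfgs_step(2)[of k] spike_nth_same by (rule abs_minus_sgn_mult[OF x_nz])
qed

lemma scale_factor_step:
  "scale_factor (step_s x k) (step_y (abs_lin a p) x k) = \<bar>step_s x k $ p\<bar> / (2 * a)"
  unfolding step_s_def step_y_def by (rule run_bfgs_step(3))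

lemma len_pos: "len k > 0"
  using t_pos[of k] d_pos[of k] by (simp add: len_def)

lemma step_s_eq: "step_s x k = spike p (- sgn (x k $ p) * len k) (- (slope k * len k))"
  unfolding step_s_def step_facts(2) by (subst d_eq) (simp add: spike_scaleR len_def mult_ac)

lemma step_s_abs: "\<bar>step_s x k $ p\<bar> = len k"
  using x_nz[of k] len_pos[of k] by (simp add: step_s_eq abs_mult abs_sgn_eq)

lemma x_Suc_le: "2 * a * \<bar>x (Suc k) $ p\<bar> \<le> (1 - c1) * (a + m * slope k) * len k"
  using armijo_len[of k] by (simp add: x_Suc algebra_simps)

text \<open>Armijo limits how far the previous step overshot the kink, while the scaling makes the
  new direction long enough: the comparison is \<open>5 * a / 4\<close> against
  \<open>2 * (a - a / 4)\<close>. The index starts at 1, as \<open>d 0\<close> is unscaled.\<close>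

lemma wolfe_2: "wolfe (abs_lin a p) c2 (x (Suc k)) (d (Suc k)) 2"
proof -
  have "\<bar>x (Suc k) $ p\<bar> < 2 * \<bar>d (Suc k) $ p\<bar>"
  proof -
    have "(1 - c1) * (a + m * slope k) < a + a / 4"
      by (rule armijo_coeff[OF slope_nonneg slope_le])
    also have "\<dots> \<le> 2 * (a - m * slope k)"
      using m_slope_le[of k] a_pos by simp
    finally have "(1 - c1) * (a + m * slope k) * len k < 2 * (a - m * slope k) * len k"
      using len_pos by (rule mult_strict_right_mono)
    then have "2 * a * \<bar>x (Suc k) $ p\<bar> < 2 * (a - m * slope k) * len k"
      using x_Suc_le[of k] by linarith
    also have "\<dots> = 2 * a * (2 * \<bar>d (Suc k) $ p\<bar>)"
      using a_pos by (simp add: d_Suc)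
    finally show ?thesis using a_pos by simp
  qed
  then show ?thesis
    using wolfe_iff[OF x_nz d_pos slope_nonneg slope_le d_eq] by simp
qed

lemma bracketing_t_le_2:
  assumes "bracketing_returns (abs_lin a p) c1 c2 (x k) (d k) (t k)" "k \<ge> 1"
  shows "t k \<le> 2"
  using bracketing_le_2[OF assms(1)] wolfe_2[of "k - 1"] assms(2) by simp

text \<open>The distance of the intermediate iterate from the kink is bounded above by Armijo at
  step \<open>k\<close> and below by Armijo at the next step.\<close>

lemma len_Suc_le_armijo:
  "len (Suc k) * (2 * a - (1 - c1) * (a + m * slope (Suc k))) \<le> (1 - c1) * (a + m * slope k) * len k"
  using armijo_len[of "Suc k"] x_Suc_le[of k] by linarith

lemma len_Suc_le_bounded:
  assumes "t (Suc k) \<le> 2"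
  shows "len (Suc k) \<le> (1 - m * slope k / a) * len k"
proof -
  have "len (Suc k) \<le> 2 * \<bar>d (Suc k) $ p\<bar>"
    unfolding len_def using assms by (intro mult_right_mono) auto
  also have "\<dots> = (1 - m * slope k / a) * len k"
    using a_pos by (simp add: d_Suc field_simps)
  finally show ?thesis .
qed

section \<open>Summability of the step lengths and convergence\<close>

lemma summable_lenI:
  assumes le: "\<And>k. len (Suc k) \<le> q k * len k" and lim: "q \<longlonglongrightarrow> Q" and Q: "Q < 1"
  shows "summable len"
proof -
  \<comment> \<open>A constant strictly between the limit and 1 eventually dominates the
    ratios.\<close>
  obtain c where c: "Q < c" "c < 1" using Q dense by blast
  obtain N where N: "\<And>k. k \<ge> N \<Longrightarrow> q k < c"
    using order_tendstoD(2)[OF lim c(1)] by (auto simp: eventually_sequentially)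
  show ?thesis
  proof (rule summable_ratio_test[OF c(2), of N])
    fix k assume "k \<ge> N"
    note le[of k]
    also have "q k * len k \<le> c * len k"
      using \<open>k \<ge> N\<close> N[of k] len_pos[of k] by (intro mult_right_mono) auto
    finally show "norm (len (Suc k)) \<le> c * norm (len k)"
      using len_pos[of k] len_pos[of "Suc k"] by simp
  qed
qed

lemma summable_len:
  assumes "1 / c1 - 1 < a / (m * b) \<or> (\<forall>k\<ge>1. t k \<le> 2)"
  shows "summable len"
  using assms
proof
  assume "\<forall>k\<ge>1. t k \<le> 2"
  then have "len (Suc k) \<le> (1 - m * slope k / a) * len k" for k
    by (intro len_Suc_le_bounded) simp
  moreover have "(\<lambda>k. 1 - m * slope k / a) \<longlonglongrightarrow> 1 - m * b / a"
    by (intro tendsto_intros slope_tendsto) (use a_pos in simp)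
  moreover have "1 - m * b / a < 1" using a_pos b_pos m_ge by simp
  ultimately show ?thesis by (rule summable_lenI)
next
  assume i: "1 / c1 - 1 < a / (m * b)"
  define A where "A r = (1 - c1) * (a + m * r)" for r
  have A: "0 < A (slope k)" "A (slope k) < 2 * a" for k
    unfolding A_def using armijo_coeff[OF slope_nonneg slope_le, of k] a_pos by linarith+
  \<comment> \<open>Cleared of denominators, alternative (i) is exactly this inequality, which is
    also what brings the limiting ratio below 1.\<close>
  have Ab: "A b < a"
  proof -
    have "m * b * (1 - c1) < a * c1"
      using i c1_pos b_pos m_ge by (simp add: field_simps)
    then show ?thesis by (simp add: A_def algebra_simps)
  qed
  have "len (Suc k) \<le> A (slope k) / (2 * a - A (slope (Suc k))) * len k" for k
    using len_Suc_le_armijo[of k] A(2)[of "Suc k"] by (simp add: A_def[symmetric] field_simps)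
  moreover have "(\<lambda>k. A (slope k) / (2 * a - A (slope (Suc k)))) \<longlonglongrightarrow> A b / (2 * a - A b)"
    unfolding A_def
    by (intro tendsto_intros slope_tendsto LIMSEQ_Suc[OF slope_tendsto])
      (use Ab a_pos in \<open>simp add: A_def\<close>)
  moreover have "A b / (2 * a - A b) < 1" using Ab a_pos by simp
  ultimately show ?thesis by (rule summable_lenI)
qed

text \<open>Slopes are at most \<open>1 / a\<close>, so whole steps are controlled by their
  \<open>p\<close> components and the displacements sum absolutely. The limit lies on the kink
  because \<open>len\<close> dominates the distance to it.\<close>

lemma run_converges:
  assumes "summable len"
  obtains xbar where "x \<longlonglongrightarrow> xbar" "xbar $ p = 0"
proof -
  have norm_le: "norm (step_s x k) \<le> (1 + m / a) * len k" for k
  proof -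
    have "norm (step_s x k) \<le> (\<Sum>i\<in>UNIV. \<bar>step_s x k $ i\<bar>)"
      by (rule norm_le_l1_cart)
    also have "\<dots> = len k + (\<Sum>i\<in>UNIV - {p}. \<bar>step_s x k $ i\<bar>)"
      by (subst sum.remove[of _ p]) (auto simp: step_s_abs)
    also have "(\<Sum>i\<in>UNIV - {p}. \<bar>step_s x k $ i\<bar>) = (\<Sum>i\<in>UNIV - {p}. slope k * len k)"
      using slope_nonneg[of k] len_pos[of k]
      by (intro sum.cong) (auto simp: step_s_eq spike_nth abs_mult)
    also have "\<dots> = m * slope k * len k"
      by (simp add: real_card_Compl1 m_eq)
    also have "\<dots> \<le> m * (1 / a) * len k"
      using slope_le[of k] m_ge len_pos[of k] by (intro mult_right_mono mult_left_mono) auto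
    finally show ?thesis by (simp add: algebra_simps)
  qed
  have "summable (step_s x)"
    by (rule summable_comparison_test'[OF summable_mult[OF assms, of "1 + m / a"]])
      (use norm_le in auto)
  then have "(\<lambda>n. \<Sum>k<n. step_s x k) \<longlonglongrightarrow> suminf (step_s x)"
    by (rule summable_LIMSEQ)
  moreover have "(\<Sum>k<n. step_s x k) = x n - x 0" for n
    unfolding step_s_def by (rule sum_lessThan_telescope)
  ultimately have "(\<lambda>n. (x n - x 0) + x 0) \<longlonglongrightarrow> suminf (step_s x) + x 0"
    by (intro tendsto_intros) simp
  then have lim: "x \<longlonglongrightarrow> suminf (step_s x) + x 0" by simp
  have "(\<lambda>k. x k $ p) \<longlonglongrightarrow> 0"
    by (rule Lim_null_comparison[OF _ summable_LIMSEQ_zero[OF assms]])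
      (use x_less_len in \<open>auto intro!: always_eventually less_imp_le\<close>)
  then have "(suminf (step_s x) + x 0) $ p = 0"
    using tendsto_vec_nth[OF lim] LIMSEQ_unique by blast
  with lim show ?thesis by (rule that)
qed

end

section \<open>Non-optimality and conclusion\<close>

text \<open>Lowering all coordinates other than \<open>p\<close> by 1 decreases the objective by
  their number.\<close>

lemma abs_lin_no_minimizer:
  fixes p :: "'n :: finite"
  assumes "CARD('n) \<ge> 2"
  shows "\<exists>z. abs_lin a p z < abs_lin a p x"
proof
  show "abs_lin a p (x + spike p 0 (- 1)) < abs_lin a p x"
    unfolding abs_lin_add_spike using assms by simp
qed

theorem corollary14:
  fixes n :: nat and a b c1 c2 :: real
    and p :: "'n::finite" and f :: "real ^ 'n \<Rightarrow> real"
    and x0 :: "real ^ 'n" and K :: enat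
    and x d :: "nat \<Rightarrow> real ^ 'n" and t :: "nat \<Rightarrow> real"
  assumes "n = CARD('n)" and "n \<ge> 2"
    and "a \<ge> 2 * sqrt (real n - 1)"
    and "f = abs_lin a p"
    and "b = (a - sqrt (a\<^sup>2 - 3 * (real n - 1))) / (3 * (real n - 1))"
    and "0 < c1" and "c1 < c2" and "c2 < 1"
    and "x0 $ p \<noteq> 0"
    and "smbfgs_run f c1 c2 x0 K x d t"
  shows "((\<forall>k. enat k < K \<longrightarrow> bracketing_returns f c1 c2 (x k) (d k) (t k))
            \<longrightarrow> (\<forall>k\<ge>1. enat k < K \<longrightarrow> t k \<le> 2))
       \<and> ((1 / c1 - 1 < a / ((real n - 1) * b)) \<or> (\<forall>k\<ge>1. enat k < K \<longrightarrow> t k \<le> 2)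
            \<longrightarrow> K = \<infinity>
              \<and> (\<forall>N\<ge>1. scale_factor (step_s x (N - 1)) (step_y f x (N - 1))
                         = \<bar>step_s x (N - 1) $ p\<bar> / (2 * a))
              \<and> (\<lambda>N. \<bar>step_s x (N - 1) $ p\<bar> / (2 * a)) \<longlonglongrightarrow> 0
              \<and> (\<exists>xbar. x \<longlonglongrightarrow> xbar \<and> xbar $ p = 0 \<and> \<not> (\<forall>z. f xbar \<le> f z)))"
proof -
  interpret smbfgs_abs_lin_run a b c1 c2 "real n - 1" p x0 K x d t
    using assms by unfold_locales auto
  show ?thesis
  proof (intro conjI impI)
    assume "\<forall>k. enat k < K \<longrightarrow> bracketing_returns f c1 c2 (x k) (d k) (t k)"
    then show "\<forall>k\<ge>1. enat k < K \<longrightarrow> t k \<le> 2"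
      using bracketing_t_le_2 \<open>f = abs_lin a p\<close> by blast
  next
    show "K = \<infinity>" by (rule K_infinite)
    show "\<forall>N\<ge>1. scale_factor (step_s x (N - 1)) (step_y f x (N - 1)) = \<bar>step_s x (N - 1) $ p\<bar> / (2 * a)"
      unfolding \<open>f = abs_lin a p\<close> using scale_factor_step by blast
    assume "1 / c1 - 1 < a / ((real n - 1) * b) \<or> (\<forall>k\<ge>1. enat k < K \<longrightarrow> t k \<le> 2)"
    then have len: "summable len"
      by (intro summable_len) (simp add: K_infinite)
    \<comment> \<open>Truncated subtraction repeats \<open>len 0\<close> at \<open>N = 0\<close>;
      shifting the sequence by one index removes this.\<close>
    have "(\<lambda>N. len (N - 1)) \<longlonglongrightarrow> 0"
      by (rule LIMSEQ_imp_Suc) (simp add: summable_LIMSEQ_zero[OF len])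
    then show "(\<lambda>N. \<bar>step_s x (N - 1) $ p\<bar> / (2 * a)) \<longlonglongrightarrow> 0"
      unfolding step_s_abs by (rule tendsto_divide_zero)
    obtain xbar where "x \<longlonglongrightarrow> xbar" "xbar $ p = 0"
      using run_converges[OF len] .
    moreover have "\<not> (\<forall>z. f xbar \<le> f z)"
      using abs_lin_no_minimizer[of a p xbar] assms(1,2,4) by (auto simp: not_le)
    ultimately show "\<exists>xbar. x \<longlonglongrightarrow> xbar \<and> xbar $ p = 0 \<and> \<not> (\<forall>z. f xbar \<le> f z)"
      by blast
  qed
qed

end
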